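(* A finite cyclic group is an $\mathrm{NCI}^{(2)}$-group if and only if its order is not divisible by $8$.
   Context: Let $G$ be a finite group and $\mathrm{Sym}(G)$ the group of all permutations of the set $G$. Let $G_r\leq \mathrm{Sym}(G)$ be the group of all right translations $x\mapsto xg$, $g\in G$, and let $\mathrm{Hol}(G)=N_{\mathrm{Sym}(G)}(G_r)=G_r\rtimes \mathrm{Aut}(G)$. For $K\leq \mathrm{Sym}(G)$, the 2-closure $K^{(2)}$ is the largest subgroup of $\mathrm{Sym}(G)$ having the same orbits on $G\times G$ (under componentwise action) as $K$; $K$ is 2-closed if $K^{(2)}=K$. A subgroup of $\mathrm{Sym}(G)$ is $G$-regular if it is regular on $G$ and isomorphic to $G$. A group $K$ with $G_r\leq K\leq \mathrm{Sym}(G)$ is $G$-transjugate if every $G$-regular subgroup of $K$ is conjugate in $K$ to $G_r$. The group $G$ is an $\mathrm{NCI}^{(2)}$-group if every 2-closed group $K$ with $G_r\leq K\leq \mathrm{Hol}(G)$ is $G$-transjugate. *)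

theory Defs
  imports "HOL-Algebra.Algebra"
begin

abbreviation perm_subgroup :: "'a set \<Rightarrow> ('a \<Rightarrow> 'a) set \<Rightarrow> ('a \<Rightarrow> 'a) monoid"
  where "perm_subgroup S K \<equiv> (BijGroup S)\<lparr>carrier := K\<rparr>"

definition right_translations :: "('a, 'b) monoid_scheme \<Rightarrow> ('a \<Rightarrow> 'a) set"
  where "right_translations G =
    {(\<lambda>x \<in> carrier G. x \<otimes>\<^bsub>G\<^esub> g) | g. g \<in> carrier G}"

definition holomorph :: "('a, 'b) monoid_scheme \<Rightarrow> ('a \<Rightarrow> 'a) set"
  where "holomorph G = normalizer (BijGroup (carrier G)) (right_translations G)"

text \<open>Permutations in \<^const>\<open>Bij\<close> are extensional, so the componentwise action has to be
  restricted to \<open>S \<times> S\<close> for it to be an action in the sense of \<^locale>\<open>group_action\<close>.\<close>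

definition pair_action :: "'a set \<Rightarrow> ('a \<Rightarrow> 'a) \<Rightarrow> 'a \<times> 'a \<Rightarrow> 'a \<times> 'a"
  where "pair_action S f = restrict (map_prod f f) (S \<times> S)"

definition pair_orbits :: "'a set \<Rightarrow> ('a \<Rightarrow> 'a) set \<Rightarrow> ('a \<times> 'a) set set"
  where "pair_orbits S K = orbits (perm_subgroup S K) (S \<times> S) (pair_action S)"

text \<open>The greatest element is taken with respect to inclusion; it exists for every subgroup
  \<open>K\<close> by \<open>two_closure_eq\<close> below.\<close>

definition two_closure :: "'a set \<Rightarrow> ('a \<Rightarrow> 'a) set \<Rightarrow> ('a \<Rightarrow> 'a) set"
  where "two_closure S K =
    (GREATEST L. subgroup L (BijGroup S) \<and> pair_orbits S L = pair_orbits S K)"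

definition two_closed :: "'a set \<Rightarrow> ('a \<Rightarrow> 'a) set \<Rightarrow> bool"
  where "two_closed S K \<longleftrightarrow> two_closure S K = K"

definition regular_subgroup :: "'a set \<Rightarrow> ('a \<Rightarrow> 'a) set \<Rightarrow> bool"
  where "regular_subgroup S R \<longleftrightarrow>
    subgroup R (BijGroup S) \<and>
    transitive_action (perm_subgroup S R) S (\<lambda>f. f) \<and>
    (\<forall>x\<in>S. stabilizer (perm_subgroup S R) (\<lambda>f. f) x = {\<one>\<^bsub>BijGroup S\<^esub>})"

definition G_regular :: "('a, 'b) monoid_scheme \<Rightarrow> ('a \<Rightarrow> 'a) set \<Rightarrow> bool"
  where "G_regular G R \<longleftrightarrow>
    regular_subgroup (carrier G) R \<and> perm_subgroup (carrier G) R \<cong> G"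

definition G_transjugate :: "('a, 'b) monoid_scheme \<Rightarrow> ('a \<Rightarrow> 'a) set \<Rightarrow> bool"
  where "G_transjugate G K \<longleftrightarrow>
    (\<forall>R. G_regular G R \<and> R \<subseteq> K \<longrightarrow>
      (\<exists>k\<in>K. R = k <#\<^bsub>BijGroup (carrier G)\<^esub> right_translations G
                  #>\<^bsub>BijGroup (carrier G)\<^esub> (inv\<^bsub>BijGroup (carrier G)\<^esub> k)))"

definition NCI2_group :: "('a, 'b) monoid_scheme \<Rightarrow> bool"
  where "NCI2_group G \<longleftrightarrow>
    (\<forall>K. subgroup K (BijGroup (carrier G)) \<and> right_translations G \<subseteq> K \<and> K \<subseteq> holomorph G
         \<and> two_closed (carrier G) K \<longrightarrow> G_transjugate G K)"

lemma perm_subgroup_mem_closed: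
  assumes "subgroup K (BijGroup S)" "f \<in> K"
  shows "f \<in> Bij S" "x \<in> S \<Longrightarrow> f x \<in> S"
proof -
  show *: "f \<in> Bij S"
    using subgroup.subset[OF assms(1)] assms(2) by (auto simp: BijGroup_def)
  show "f x \<in> S" if "x \<in> S" using Bij_imp_funcset[OF *] that by auto
qed

lemma perm_subgroup_compose:
  assumes "subgroup K (BijGroup S)" "f \<in> K" "g \<in> K"
  shows "compose S f g \<in> K"
  using subgroup.m_closed[OF assms] perm_subgroup_mem_closed(1)[OF assms(1)] assms(2,3)
  by (simp add: BijGroup_def)

lemma perm_subgroup_inv:
  assumes "subgroup K (BijGroup S)" "f \<in> K" "x \<in> S"
  obtains g where "g \<in> K" "g (f x) = x" "\<And>y. y \<in> S \<Longrightarrow> g (f y) = y"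
proof -
  have f: "f \<in> Bij S" using perm_subgroup_mem_closed(1)[OF assms(1,2)] .
  have "(\<lambda>x \<in> S. inv_into S f x) \<in> K"
    using subgroup.m_inv_closed[OF assms(1,2)] inv_BijGroup[OF f] by simp
  moreover have "(\<lambda>x \<in> S. inv_into S f x) (f y) = y" if "y \<in> S" for y
    using f that by (auto simp: Bij_def bij_betw_def inv_into_f_f)
  ultimately show thesis using that assms(3) by blast
qed

lemma pair_orbit_eq:
  assumes "x \<in> S" "y \<in> S"
  shows "orbit (perm_subgroup S K) (pair_action S) (x, y) = {(f x, f y) | f. f \<in> K}"
  using assms by (auto simp: orbit_def pair_action_def)

lemma pair_orbits_image:
  "pair_orbits S K = (\<lambda>(x, y). {(f x, f y) | f. f \<in> K}) ` (S \<times> S)"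
proof -
  have "pair_orbits S K = orbit (perm_subgroup S K) (pair_action S) ` (S \<times> S)"
    unfolding pair_orbits_def orbits_def by blast
  also have "\<dots> = (\<lambda>(x, y). {(f x, f y) | f. f \<in> K}) ` (S \<times> S)"
  proof (rule image_cong[OF refl])
    fix p assume "p \<in> S \<times> S"
    then obtain x y where p: "p = (x, y)" "x \<in> S" "y \<in> S" by blast
    show "orbit (perm_subgroup S K) (pair_action S) p = (case p of (x, y) \<Rightarrow> {(f x, f y) | f. f \<in> K})"
      unfolding p(1) prod.case by (rule pair_orbit_eq[OF p(2,3)])
  qed
  finally show ?thesis .
qed

lemma two_closure_eq:
  assumes K: "subgroup K (BijGroup S)"
  shows "two_closure S K = {f \<in> Bij S. \<forall>x\<in>S. \<forall>y\<in>S. \<exists>k\<in>K. f x = k x \<and> f y = k y}"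
    (is "_ = ?M")
  unfolding two_closure_def
proof (rule Greatest_equality)
  note KS = perm_subgroup_mem_closed[OF K]
  have KM: "K \<subseteq> ?M" using KS by auto
  have "subgroup ?M (BijGroup S)"
  proof (rule group.subgroupI[OF group_BijGroup])
    show "?M \<subseteq> carrier (BijGroup S)" by (auto simp: BijGroup_def)
    show "?M \<noteq> {}" using KM subgroup.one_closed[OF K] by blast
  next
    fix f assume f: "f \<in> ?M"
    then have b: "bij_betw f S S" "f \<in> Bij S" by (auto simp: Bij_def)
    let ?g = "\<lambda>x \<in> S. inv_into S f x"
    have "\<exists>k\<in>K. ?g x = k x \<and> ?g y = k y" if xy: "x \<in> S" "y \<in> S" for x y
    proof -
      have m: "?g x \<in> S" "?g y \<in> S" "f (?g x) = x" "f (?g y) = y"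
        using xy b(1) by (auto simp: bij_betw_def f_inv_into_f inv_into_into)
      then obtain k where k: "k \<in> K" "f (?g x) = k (?g x)" "f (?g y) = k (?g y)"
        using f by blast
      obtain h where "h \<in> K" "\<And>y. y \<in> S \<Longrightarrow> h (k y) = y"
        using perm_subgroup_inv[OF K k(1) m(1)] by metis
      then show ?thesis using m k by metis
    qed
    then show "inv\<^bsub>BijGroup S\<^esub> f \<in> ?M"
      unfolding inv_BijGroup[OF b(2)] using restrict_inv_into_Bij[OF b(2)] by blast
  next
    fix f g assume fg: "f \<in> ?M" "g \<in> ?M"
    have "\<exists>k\<in>K. compose S f g x = k x \<and> compose S f g y = k y"
      if xy: "x \<in> S" "y \<in> S" for x y
    proof -
      obtain k where k: "k \<in> K" "g x = k x" "g y = k y" using fg xy by blast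
      obtain h where h: "h \<in> K" "f (k x) = h (k x)" "f (k y) = h (k y)"
        using fg KS(2)[OF k(1)] xy by blast
      show ?thesis
        using perm_subgroup_compose[OF K h(1) k(1)] xy k h
        by (intro bexI[of _ "compose S h k"]) (auto simp: compose_def)
    qed
    then show "f \<otimes>\<^bsub>BijGroup S\<^esub> g \<in> ?M"
      using fg compose_Bij by (auto simp: BijGroup_def)
  qed
  moreover have "pair_orbits S ?M = pair_orbits S K"
    unfolding pair_orbits_image
  proof (rule image_cong[OF refl])
    fix p assume "p \<in> S \<times> S"
    then obtain x y where p: "p = (x, y)" "x \<in> S" "y \<in> S" by blast
    have "{(f x, f y) | f. f \<in> ?M} \<subseteq> {(f x, f y) | f. f \<in> K}"
      using p(2,3) by fastforce
    moreover have "{(f x, f y) | f. f \<in> K} \<subseteq> {(f x, f y) | f. f \<in> ?M}"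
      using KM by blast
    ultimately show "(case p of (x, y) \<Rightarrow> {(f x, f y) | f. f \<in> ?M}) =
        (case p of (x, y) \<Rightarrow> {(f x, f y) | f. f \<in> K})"
      unfolding p(1) prod.case by (rule equalityI)
  qed
  ultimately show "subgroup ?M (BijGroup S) \<and> pair_orbits S ?M = pair_orbits S K" by blast
next
  fix L assume L: "subgroup L (BijGroup S) \<and> pair_orbits S L = pair_orbits S K"
  then have LS: "subgroup L (BijGroup S)" by blast
  show "L \<subseteq> ?M"
  proof safe
    fix f assume f: "f \<in> L"
    show "f \<in> Bij S" using perm_subgroup_mem_closed[OF LS f] by blast
    fix x y assume xy: "x \<in> S" "y \<in> S"
    have "{(f x, f y) | f. f \<in> L} \<in> pair_orbits S K"
    proof -
      have "{(f x, f y) | f. f \<in> L} \<in> pair_orbits S L"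
        unfolding pair_orbits_image using xy
        by (intro image_eqI[of _ _ "(x, y)"]) auto
      then show ?thesis using L by simp
    qed
    then obtain u v where uv: "u \<in> S" "v \<in> S"
      "{(f x, f y) | f. f \<in> L} = {(f u, f v) | f. f \<in> K}"
      unfolding pair_orbits_image by (elim imageE SigmaE) (simp only: prod.case)
    have "(\<lambda>x\<in>S. x) \<in> L" using subgroup.one_closed[OF LS] by (simp add: BijGroup_def)
    then have "(x, y) \<in> {(f x, f y) | f. f \<in> L}"
      using xy by (intro CollectI exI[of _ "\<lambda>x\<in>S. x"]) simp
    then obtain k where k: "k \<in> K" "k u = x" "k v = y" using uv(3) by auto
    have "(f x, f y) \<in> {(f x, f y) | f. f \<in> L}" using f by blast
    then obtain h where h: "h \<in> K" "h u = f x" "h v = f y" unfolding uv(3) by auto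
    obtain j where j: "j \<in> K" "\<And>y. y \<in> S \<Longrightarrow> j (k y) = y"
      using perm_subgroup_inv[OF K k(1) uv(1)] by metis
    have "j x = u" "j y = v" using j(2) uv k by auto
    then show "\<exists>k\<in>K. f x = k x \<and> f y = k y"
      using perm_subgroup_compose[OF K h(1) j(1)] xy h
      by (intro bexI[of _ "compose S h j"]) (auto simp: compose_def)
  qed
qed

end

theory Submission
  imports Defs "HOL-Number_Theory.Residues"
begin

text \<open>
  Fix a generator \<open>g\<close> of the cyclic group \<open>G\<close> of order \<open>N\<close>. Conjugating the translation by \<open>g\<close> by an
  element of the holomorph gives another translation, so the holomorph consists of the maps
  \<open>x \<mapsto> x\<^sup>a g\<^sup>b\<close>; on exponents these are the affine maps \<open>i \<mapsto> a i + b\<close> modulo \<open>N\<close>. The right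
  translations are normal in the holomorph, hence a group \<open>K\<close> between the two is transjugate exactly
  when the right translations are its only \<open>G\<close>-regular subgroup (\<open>transjugate_iff\<close>). So everything
  turns on affine maps with a single cycle of length \<open>N\<close>.

  Suppose \<open>8\<close> does not divide \<open>N\<close>, and let a \<open>2\<close>-closed \<open>K\<close> contain a \<open>G\<close>-regular subgroup,
  generated by \<open>i \<mapsto> a i + b\<close>. Transitivity modulo each divisor of \<open>N\<close> forces \<open>a \<equiv> 1\<close> modulo every
  prime divisor of \<open>N\<close>, and modulo \<open>4\<close> if \<open>4\<close> divides \<open>N\<close>. If \<open>a \<noteq> 1\<close> modulo \<open>N\<close>, some power \<open>c\<close> of \<open>a\<close>
  has prime order \<open>p\<close> modulo \<open>N\<close>, and the congruences give that \<open>p\<close> is odd, \<open>p\<^sup>2\<close> divides \<open>N\<close> and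
  \<open>c \<equiv> 1\<close> modulo \<open>N/p\<close> (\<open>power_of_prime_order\<close>). Multiplying a difference not divisible by \<open>p\<close> by
  powers of \<open>c\<close> changes it by arbitrary multiples of \<open>N/p\<close>. Therefore the permutation that adds
  \<open>N/p\<close> to the multiples of \<open>p\<close> and fixes every other exponent lies in the \<open>2\<close>-closure of \<open>K\<close>
  (\<open>shift_residue_two_closure\<close>). As \<open>p\<close> is odd this permutation is not affine, contradicting
  \<open>K \<subseteq> Hol(G)\<close>. Thus \<open>a = 1\<close>, and the regular subgroup consists of translations.

  If \<open>8\<close> divides \<open>N\<close>, put \<open>h = N/2\<close>. The maps with multiplier \<open>1\<close> or \<open>1 + h\<close> form a \<open>2\<close>-closed group:
  even differences are preserved and the image of one odd difference determines all others. The
  map \<open>i \<mapsto> (1 + h) i + 1\<close> is a cycle of length \<open>N\<close> in this group, so it generates a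
  \<open>G\<close>-regular subgroup other than the right translations (\<open>not_NCI2\<close>).
\<close>

(* The unqualified name is to denote primes of the integers and natural numbers. *)
hide_const (open) Divisibility.prime

section \<open>Units of prime order\<close>

text \<open>
  Write \<open>n = d h\<close> with \<open>d = gcd(n, c - 1)\<close>. Then \<open>h\<close> divides \<open>1 + c + \<dots> + c\<^sup>p\<^sup>-\<^sup>1\<close>, which is congruent to \<open>p\<close>
  modulo every prime divisor of \<open>n\<close>, so \<open>h\<close> is a power of \<open>p\<close>. For odd \<open>p\<close> the sum is congruent to \<open>p\<close>
  even modulo \<open>p\<^sup>2\<close>, whence \<open>h = p\<close>. The congruence modulo \<open>4\<close> rules out \<open>p = 2\<close>,
  since \<open>8\<close> does not divide \<open>n\<close>.
\<close>
lemma unit_of_prime_order: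
  fixes c n :: int and p :: nat
  assumes "n > 0" "\<not> 8 dvd n" "\<not> n dvd c - 1" "prime p" "n dvd c ^ p - 1"
    and rad: "\<And>q. prime q \<Longrightarrow> q dvd n \<Longrightarrow> q dvd c - 1"
    and four: "4 dvd n \<Longrightarrow> 4 dvd c - 1"
  shows "p \<noteq> 2" "int p * int p dvd n" "n dvd int p * (c - 1)"
proof -
  define d where "d = gcd n (c - 1)"
  have d0: "d > 0" using assms(1) by (simp add: d_def)
  obtain h where h: "n = d * h" unfolding d_def by (meson gcd_dvd1 dvdE)
  obtain k where k: "c - 1 = d * k" unfolding d_def by (meson gcd_dvd2 dvdE)
  have hk: "coprime h k"
  proof -
    have "d * gcd h k = d"
      using h k d0 gcd_mult_distrib_int[of d h k] d_def by (metis abs_of_pos)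
    then show ?thesis using d0 by (simp add: coprime_iff_gcd_eq_1)
  qed
  have h0: "h > 0" using h d0 assms(1) by (simp add: zero_less_mult_iff)
  have h1: "h \<noteq> 1" using h assms(3) by (metis d_def gcd_dvd2 mult.right_neutral)
  define S where "S = (\<Sum>i<p. c ^ i)"
  have "(c - 1) * S = c ^ p - 1" unfolding S_def by (simp add: power_diff_1_eq)
  then have "d * h dvd d * (k * S)" using assms(5) h k by (metis mult.assoc)
  then have "h dvd k * S" using d0 by simp
  then have hS: "h dvd S" using hk by (simp add: coprime_dvd_mult_right_iff)
  have only: "q = int p" if "prime q" "q dvd h" for q
  proof -
    have "q dvd c - 1" using rad that h by simp
    then have "[c = 1] (mod q)" by (simp add: cong_iff_dvd_diff)
    then have "[c ^ i = 1] (mod q)" for i using cong_pow[of c 1 q i] by simp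
    then have "[S = (\<Sum>i<p. 1)] (mod q)" unfolding S_def by (intro cong_sum) auto
    then have "[S = int p] (mod q)" by simp
    then have "q dvd int p" using hS that(2) by (meson cong_dvd_iff dvd_trans)
    then show ?thesis using that(1) assms(4) by (simp add: primes_dvd_imp_eq)
  qed
  obtain q where "prime q" "q dvd h" using h0 h1
    using prime_factor_int[of h] by auto
  with only have ph: "int p dvd h" by blast
  have pc: "int p dvd c - 1" using rad[of "int p"] ph h assms(4) by simp
  have pd: "int p dvd d" using pc ph h by (metis d_def dvd_mult gcd_greatest)
  show ppn: "int p * int p dvd n" using pd ph h by (simp add: mult_dvd_mono)
  show p2: "p \<noteq> 2"
  proof
    assume "p = 2"
    then have "4 dvd n" using ppn by simp
    then have "4 dvd d" using four by (simp add: d_def)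
    then have "4 * 2 dvd d * h" using ph \<open>p = 2\<close> by (intro mult_dvd_mono) auto
    then show False using h assms(2) by simp
  qed
  have nh: "\<not> int p * int p dvd h"
  proof
    assume "int p * int p dvd h"
    then have a: "int p * int p dvd S" using hS by (rule dvd_trans)
    obtain t where t: "c = 1 + int p * t" using pc by (metis dvdE diff_add_cancel add.commute)
    \<comment> \<open>Binomial expansion of \<open>(1 + p t)\<^sup>i\<close> to first order in \<open>p\<close>.\<close>
    have ci: "[c ^ i = 1 + int i * int p * t] (mod (int p * int p))" for i
    proof (induction i)
      case (Suc i)
      have "[c * c ^ i = (1 + int p * t) * (1 + int i * int p * t)] (mod (int p * int p))"
        unfolding t[symmetric] using Suc by (rule cong_scalar_left)
      moreover have "(1 + int p * t) * (1 + int i * int p * t) =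
          1 + int (Suc i) * int p * t + (int p * int p) * (int i * t * t)"
        by (simp add: algebra_simps)
      ultimately show ?case by (metis (no_types, lifting) cong_mult_self_left cong_add_lcancel_0 cong_trans power_Suc)
    qed simp
    have "[S = (\<Sum>i<p. 1 + int i * int p * t)] (mod (int p * int p))"
      unfolding S_def by (intro cong_sum ci)
    also have "(\<Sum>i<p. 1 + int i * int p * t) = int p + (\<Sum>i<p. int i) * int p * t"
      by (simp add: sum.distrib sum_distrib_right)
    finally have S: "[S = int p + (\<Sum>i<p. int i) * int p * t] (mod (int p * int p))" .
    have "2 * (\<Sum>i<p. int i) = int p * (int p - 1)"
      by (induction p) (auto simp: algebra_simps)
    then have "int p dvd 2 * (\<Sum>i<p. int i)" by simp
    moreover have "coprime (int p) 2" using p2 assms(4)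
      by (metis coprime_int_iff of_nat_numeral primes_coprime two_is_prime_nat)
    ultimately have "int p dvd (\<Sum>i<p. int i)" by (simp add: coprime_dvd_mult_right_iff)
    then have "int p * int p dvd (\<Sum>i<p. int i) * int p * t"
      by (simp add: mult_dvd_mono)
    moreover have "int p * int p dvd int p + (\<Sum>i<p. int i) * int p * t"
      using a S by (simp add: cong_dvd_iff)
    ultimately have "int p * int p dvd int p * 1" by (simp add: dvd_add_left_iff)
    then have "int p dvd 1" using assms(4)
      by (metis dvd_mult_cancel_left of_nat_0_eq_iff not_prime_0)
    then show False using assms(4) by simp
  qed
  obtain h' where h': "h = int p * h'" using ph by blast
  have "h' = 1"
  proof (rule ccontr)
    assume "h' \<noteq> 1"
    moreover have "h' > 0" using h' h0 by (simp add: zero_less_mult_iff)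
    ultimately obtain q where q: "prime q" "q dvd h'"
      using prime_factor_int[of h'] by auto
    then have "q = int p" using only h' by simp
    then show False using nh h' q(2) by simp
  qed
  then show "n dvd int p * (c - 1)" using h h' k by (simp add: mult.assoc mult.left_commute)
qed

text \<open>
  The hypotheses on \<open>a\<close> are those met by the multiplier of an affine \<open>n\<close>-cycle. They pass to powers
  of \<open>a\<close>, so a nontrivial multiplier may be replaced by a power of prime order modulo \<open>n\<close>.
\<close>
lemma power_of_prime_order:
  fixes a n :: int
  assumes "n > 0" "\<not> 8 dvd n" "\<not> n dvd a - 1"
    and rad: "\<And>q. prime q \<Longrightarrow> q dvd n \<Longrightarrow> q dvd a - 1"
    and four: "4 dvd n \<Longrightarrow> 4 dvd a - 1"
  obtains e :: nat and p :: nat where "prime p" "p \<noteq> 2" "int p * int p dvd n"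
    "n dvd int p * (a ^ e - 1)" "\<not> n dvd a ^ e - 1"
proof -
  have "coprime a n"
  proof (rule ccontr)
    assume "\<not> coprime a n"
    then have "\<bar>gcd a n\<bar> \<noteq> 1" by (simp add: coprime_iff_gcd_eq_1)
    then obtain q where q: "prime q" "q dvd a" "q dvd n"
      using prime_factor_int[of "gcd a n"] by auto
    then have "q dvd 1" using rad[OF q(1,3)] by (metis dvd_diff_commute dvd_add_right_iff diff_add_cancel)
    then show False using q(1) not_prime_unit by blast
  qed
  then have "coprime (nat (a mod n)) (nat n)" using assms(1)
    by (simp add: coprime_int_iff[symmetric] coprime_mod_left_iff)
  then have "[nat (a mod n) ^ totient (nat n) = 1] (mod nat n)" by (rule euler_theorem)
  then have "[int (nat (a mod n) ^ totient (nat n)) = int 1] (mod int (nat n))"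
    by (simp only: cong_int_iff)
  then have "[(a mod n) ^ totient (nat n) = 1] (mod n)" using assms(1) by simp
  then have "[a ^ totient (nat n) = 1] (mod n)" by (simp add: cong_def power_mod)
  moreover have "totient (nat n) > 0" using assms(1) by simp
  ultimately have ex: "\<exists>k>0. n dvd a ^ k - 1" unfolding cong_iff_dvd_diff by blast
  define r where "r = (LEAST k. k > 0 \<and> n dvd a ^ k - 1)"
  have r: "r > 0" "n dvd a ^ r - 1" using LeastI_ex[OF ex] by (auto simp: r_def)
  have min: "\<not> n dvd a ^ k - 1" if "k > 0" "k < r" for k
    using not_less_Least[of k "\<lambda>k. k > 0 \<and> n dvd a ^ k - 1"] that by (auto simp: r_def)
  have "r \<noteq> 1" using r assms(3) by auto
  then obtain p where p: "prime p" "p dvd r" using prime_factor_nat by blast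
  then obtain e where e: "r = e * p" by (metis dvdE mult.commute)
  have e0: "e > 0" "e < r" using e r(1) prime_gt_1_nat[OF p(1)] by auto
  have d: "a - 1 dvd a ^ e - 1" by (simp add: power_diff_1_eq)
  have *: "n dvd (a ^ e) ^ p - 1" using r(2) e by (simp add: power_mult)
  note pou = unit_of_prime_order[OF assms(1,2) min[OF e0] p(1) *]
  show thesis
    by (rule that[OF p(1) pou(1) pou(2) pou(3) min[OF e0]])
       (use rad four d dvd_trans in blast)+
qed

section \<open>Isomorphism of finite cyclic groups\<close>

lemma (in group) ord_generator:
  assumes "x \<in> carrier G" "carrier G = range (\<lambda>i::int. x [^] i)"
  shows "ord x = order G"
  using cyclic_order_is_ord[OF assms(1)] generate_pow[OF assms(1)] assms
  by (simp add: order_def carrier_subgroup_generated_by_singleton full_SetCompr_eq)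

text \<open>
  Both groups are quotients of the integers with the same kernel, so exponents with respect to
  chosen generators can be matched.
\<close>
lemma cyclic_groups_iso:
  assumes "group G" "group H" "cyclic_group G" "cyclic_group H" "order G = order H"
    "finite (carrier G)" "finite (carrier H)"
  shows "G \<cong> H"
proof -
  interpret G: group G by fact
  interpret H: group H by fact
  obtain x where x: "x \<in> carrier G" "carrier G = range (\<lambda>i::int. x [^]\<^bsub>G\<^esub> i)"
    using assms(3) G.cyclic_group by blast
  obtain y where y: "y \<in> carrier H" "carrier H = range (\<lambda>i::int. y [^]\<^bsub>H\<^esub> i)"
    using assms(4) H.cyclic_group by blast
  have ox: "G.ord x = order G" by (rule G.ord_generator[OF x])
  have oy: "H.ord y = order H" by (rule H.ord_generator[OF y])
  have eq: "x [^]\<^bsub>G\<^esub> i = x [^]\<^bsub>G\<^esub> j \<longleftrightarrow> y [^]\<^bsub>H\<^esub> i = y [^]\<^bsub>H\<^esub> j" for i j :: int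
    using G.int_pow_eq[OF x(1)] H.int_pow_eq[OF y(1)] ox oy assms(5) by simp
  define f where "f u = y [^]\<^bsub>H\<^esub> (SOME i::int. u = x [^]\<^bsub>G\<^esub> i)" for u
  have f: "f (x [^]\<^bsub>G\<^esub> i) = y [^]\<^bsub>H\<^esub> i" for i :: int
  proof -
    have "x [^]\<^bsub>G\<^esub> i = x [^]\<^bsub>G\<^esub> (SOME j::int. x [^]\<^bsub>G\<^esub> i = x [^]\<^bsub>G\<^esub> j)" 
      by (rule someI[of _ i]) (rule refl)
    then show ?thesis unfolding f_def by (metis eq)
  qed
  have "f \<in> hom G H"
    unfolding hom_def using x y f
    by (auto simp: G.int_pow_mult[symmetric] H.int_pow_mult[symmetric])
  moreover have "bij_betw f (carrier G) (carrier H)"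
    unfolding bij_betw_def inj_on_def x(2) y(2) using f eq by (auto simp: image_image)
  ultimately show ?thesis by (auto simp: is_iso_def iso_def)
qed

section \<open>The holomorph of a finite cyclic group\<close>

locale finite_cyclic_group = group G for G (structure) +
  fixes g
  assumes finite_carrier: "finite (carrier G)"
    and gen_closed: "g \<in> carrier G"
    and carrier_eq: "carrier G = range (\<lambda>i::int. g [^] i)"
begin

abbreviation S where "S \<equiv> carrier G"
abbreviation N where "N \<equiv> int (order G)"
abbreviation Sym where "Sym \<equiv> BijGroup S"

lemma N_pos: "N > 0"
  using finite_carrier order_gt_0_iff_finite by simp

lemma gen_pow_closed [simp]: "g [^] (i::int) \<in> S"
  using gen_closed by simp

lemma gen_pow_eq_iff: "g [^] (i::int) = g [^] j \<longleftrightarrow> N dvd i - j"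
proof -
  have "ord g = order G" by (rule ord_generator[OF gen_closed carrier_eq])
  then show ?thesis using int_pow_eq[OF gen_closed, of i j]
    by (metis dvd_diff_commute)
qed

lemma carrierE:
  assumes "x \<in> S" obtains i :: int where "x = g [^] i"
  using assms carrier_eq by auto

lemma extensional_eqI:
  assumes "f \<in> extensional S" "h \<in> extensional S"
    "\<And>i::int. f (g [^] i) = h (g [^] i)"
  shows "f = h"
  using assms by (intro extensionalityI[of f S h]) (auto elim: carrierE)

text \<open>
  Multiplier and translation part are integers rather than residues, and any integer multiplier is
  admitted; \<open>affine a b\<close> is a permutation when \<open>a\<close> is prime to \<open>N\<close>.
\<close>
definition affine :: "int \<Rightarrow> int \<Rightarrow> 'a \<Rightarrow> 'a"
  where "affine a b = (\<lambda>x\<in>S. x [^] a \<otimes> g [^] b)"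

lemma affine_gen_pow [simp]: "affine a b (g [^] i) = g [^] (a * i + b)"
  by (simp add: affine_def gen_closed int_pow_pow int_pow_mult mult.commute)

lemma affine_extensional [simp]: "affine a b \<in> extensional S"
  by (simp add: affine_def)

lemma affine_eq_iff: "affine a b = affine c d \<longleftrightarrow> N dvd a - c \<and> N dvd b - d"
proof
  assume e: "affine a b = affine c d"
  have "N dvd b - d" using arg_cong[OF e, of "\<lambda>f. f (g [^] (0::int))"]
    by (simp only: affine_gen_pow gen_pow_eq_iff) simp
  moreover have "N dvd a + b - (c + d)" using arg_cong[OF e, of "\<lambda>f. f (g [^] (1::int))"]
    by (simp only: affine_gen_pow gen_pow_eq_iff) simp
  ultimately have "N dvd (a + b - (c + d)) - (b - d)" by (rule dvd_diff[rotated])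
  with \<open>N dvd b - d\<close> show "N dvd a - c \<and> N dvd b - d" by simp
next
  assume "N dvd a - c \<and> N dvd b - d"
  then have "N dvd (a - c) * i + (b - d)" for i by simp
  then have "N dvd (a * i + b) - (c * i + d)" for i
    by (metis (no_types, opaque_lifting) add_diff_add left_diff_distrib)
  then show "affine a b = affine c d"
    by (intro extensional_eqI) (simp_all add: gen_pow_eq_iff)
qed

lemma compose_affine: "compose S (affine a b) (affine c d) = affine (a * c) (a * d + b)"
  by (intro extensional_eqI) (auto simp: compose_def algebra_simps)

lemma injective_imp_Bij:
  assumes "f \<in> extensional S" "f ` S \<subseteq> S" "inj_on f S"
  shows "f \<in> Bij S"
  using assms endo_inj_surj[OF finite_carrier] by (simp add: Bij_def bij_betw_def)

lemma affine_Bij: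
  assumes "coprime a N" shows "affine a b \<in> Bij S"
proof (rule injective_imp_Bij)
  show "affine a b ` S \<subseteq> S" by (auto elim!: carrierE)
  show "inj_on (affine a b) S"
  proof (rule inj_onI)
    fix x y assume "x \<in> S" "y \<in> S" and e: "affine a b x = affine a b y"
    then obtain i j where ij: "x = g [^] (i::int)" "y = g [^] (j::int)" by (metis carrierE)
    then have "N dvd a * (i - j)" using e by (simp add: gen_pow_eq_iff algebra_simps)
    then have "N dvd i - j" using assms
      by (simp add: coprime_commute coprime_dvd_mult_right_iff)
    then show "x = y" using ij by (simp add: gen_pow_eq_iff)
  qed
qed simp

lemma Sym_mult: "f \<in> Bij S \<Longrightarrow> h \<in> Bij S \<Longrightarrow> f \<otimes>\<^bsub>Sym\<^esub> h = compose S f h"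
  by (simp add: BijGroup_def)

lemma carrier_Sym: "carrier Sym = Bij S"
  by (simp add: BijGroup_def)

lemma translation_Sym [simp]: "affine 1 b \<in> carrier Sym"
  by (simp add: carrier_Sym affine_Bij)

lemma one_Sym: "\<one>\<^bsub>Sym\<^esub> = affine 1 0"
proof -
  have "(\<lambda>x\<in>S. x) = affine 1 0" by (intro extensional_eqI) simp_all
  then show ?thesis by (simp add: BijGroup_def)
qed

lemma mult_affine:
  "coprime a N \<Longrightarrow> coprime c N \<Longrightarrow>
    affine a b \<otimes>\<^bsub>Sym\<^esub> affine c d = affine (a * c) (a * d + b)"
  by (simp add: Sym_mult affine_Bij compose_affine)

lemma translation_Bij [simp]: "affine 1 b \<in> Bij S"
  by (simp add: affine_Bij)

lemma right_translations_eq: "right_translations G = range (affine 1)"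
proof -
  have *: "(\<lambda>x\<in>S. x \<otimes> g [^] (b::int)) = affine 1 b" for b
    by (auto simp: affine_def)
  show ?thesis
  proof
    show "right_translations G \<subseteq> range (affine 1)"
      unfolding right_translations_def by (auto elim!: carrierE simp: *)
    show "range (affine 1) \<subseteq> right_translations G"
      unfolding right_translations_def *[symmetric] by auto
  qed
qed

lemma right_translations_subset: "right_translations G \<subseteq> carrier Sym"
  by (auto simp: right_translations_eq carrier_Sym)

lemma mem_holomorph_iff:
  "f \<in> holomorph G \<longleftrightarrow> f \<in> carrier Sym \<and>
     f <#\<^bsub>Sym\<^esub> right_translations G #>\<^bsub>Sym\<^esub> inv\<^bsub>Sym\<^esub> f = right_translations G"
  using right_translations_subset by (auto simp: holomorph_def normalizer_def stabilizer_def)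

text \<open>
  If \<open>f\<close> conjugates the translation by \<open>g\<close> to the translation by \<open>g\<^sup>a\<close>, then raising the
  exponent of the argument by one multiplies the value of \<open>f\<close> by \<open>g\<^sup>a\<close>; so \<open>f\<close> is determined by
  \<open>a\<close> and its value at the identity.
\<close>
lemma holomorph_imp_affine:
  assumes "f \<in> holomorph G"
  obtains a b where "f = affine a b"
proof -
  interpret Y: group Sym by (rule group_BijGroup)
  note f = assms[unfolded mem_holomorph_iff]
  have fB: "f \<in> Bij S" using f carrier_Sym by simp
  have "f \<otimes>\<^bsub>Sym\<^esub> affine 1 1 \<otimes>\<^bsub>Sym\<^esub> inv\<^bsub>Sym\<^esub> f \<in> right_translations G"
    using f unfolding right_translations_eq l_coset_def r_coset_def by blast
  then obtain a where a: "f \<otimes>\<^bsub>Sym\<^esub> affine 1 1 \<otimes>\<^bsub>Sym\<^esub> inv\<^bsub>Sym\<^esub> f = affine 1 a"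
    unfolding right_translations_eq by blast
  have "f \<otimes>\<^bsub>Sym\<^esub> affine 1 1 = affine 1 a \<otimes>\<^bsub>Sym\<^esub> f"
    unfolding a[symmetric] using f by (simp add: Y.m_assoc translation_Sym)
  then have c: "compose S f (affine 1 1) = compose S (affine 1 a) f"
    using fB by (simp add: Sym_mult)
  have fS: "f (g [^] (i::int)) \<in> S" for i using Bij_imp_funcset[OF fB] by auto
  have step: "f (g [^] (i + 1)) = f (g [^] i) \<otimes> g [^] a" for i :: int
    using fun_cong[OF c, of "g [^] i"] fS[of i] by (simp add: compose_def affine_def int_pow_mult gen_closed)
  obtain b where b: "f (g [^] (0::int)) = g [^] (b::int)" using fS carrierE by blast
  have "f (g [^] i) = g [^] (a * i + b)" for i :: int
  proof (induction i rule: int_induct[where k = 0])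
    case base show ?case using b by simp
  next
    case (step1 i)
    then have "f (g [^] (i + 1)) = g [^] (a * i + b) \<otimes> g [^] a" by (simp only: step)
    then show ?case by (simp add: int_pow_mult[symmetric] gen_closed algebra_simps)
  next
    case (step2 i)
    obtain k where k: "f (g [^] (i - 1)) = g [^] (k::int)" using fS carrierE by blast
    have "g [^] (k + a) = g [^] (a * i + b)"
      using step[of "i - 1"] step2 k by (simp add: int_pow_mult gen_closed)
    then have "N dvd k - (a * (i - 1) + b)" by (simp add: gen_pow_eq_iff algebra_simps)
    then show ?case by (simp add: k gen_pow_eq_iff)
  qed
  then have "f = affine a b"
    by (intro extensional_eqI) (simp_all add: Bij_imp_extensional[OF fB])
  then show thesis by (rule that)
qed

lemma affine_holomorph:
  assumes a: "coprime a N"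
  shows "affine a b \<in> holomorph G"
proof -
  interpret Y: group Sym by (rule group_BijGroup)
  let ?f = "affine a b"
  have f: "?f \<in> carrier Sym" by (simp add: affine_Bij a carrier_Sym)
  have "?f <#\<^bsub>Sym\<^esub> right_translations G = range (\<lambda>c. affine a (a * c + b))"
    unfolding l_coset_def right_translations_eq using a by (auto simp: mult_affine)
  also have "\<dots> = range (\<lambda>d. affine a (b + d))"
  proof
    show "range (\<lambda>c. affine a (a * c + b)) \<subseteq> range (\<lambda>d. affine a (b + d))"
      by (auto simp: add.commute)
    show "range (\<lambda>d. affine a (b + d)) \<subseteq> range (\<lambda>c. affine a (a * c + b))"
    proof safe
      fix d
      obtain a' where "[a * a' = 1] (mod N)" using a cong_solve_coprime_int by blast
      then have "[a * a' * d = 1 * d] (mod N)" by (rule cong_scalar_right)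
      then have "N dvd a * a' * d - d" by (simp add: cong_iff_dvd_diff)
      then have "affine a (b + d) = affine a (a * (a' * d) + b)"
        by (simp add: affine_eq_iff dvd_diff_commute[of _ d] mult.assoc)
      then show "affine a (b + d) \<in> range (\<lambda>c. affine a (a * c + b))" by blast
    qed
  qed
  also have "\<dots> = right_translations G #>\<^bsub>Sym\<^esub> ?f"
    unfolding r_coset_def right_translations_eq using a by (auto simp: mult_affine add.commute)
  finally have "?f <#\<^bsub>Sym\<^esub> right_translations G #>\<^bsub>Sym\<^esub> inv\<^bsub>Sym\<^esub> ?f =
      right_translations G"
    using f right_translations_subset by (simp add: Y.coset_mult_assoc)
  then show ?thesis using f by (simp add: mem_holomorph_iff)
qed

text \<open>
  Conjugation by elements of the holomorph fixes the group of right translations, so conjugacy to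
  it is equality with it.
\<close>
lemma transjugate_iff:
  assumes "subgroup K Sym" "K \<subseteq> holomorph G"
  shows "G_transjugate G K \<longleftrightarrow> (\<forall>R. G_regular G R \<and> R \<subseteq> K \<longrightarrow> R = right_translations G)"
proof -
  have "K \<noteq> {}" using subgroup.one_closed[OF assms(1)] by blast
  moreover have "k <#\<^bsub>Sym\<^esub> right_translations G #>\<^bsub>Sym\<^esub> inv\<^bsub>Sym\<^esub> k = right_translations G"
    if "k \<in> K" for k
    using that assms(2) mem_holomorph_iff by blast
  ultimately show ?thesis unfolding G_transjugate_def by (metis all_not_in_conv)
qed

section \<open>Regular affine cycles and the two-closure\<close>

lemma G_regular_generator:
  assumes "G_regular G R"
  obtains f where "f \<in> R" "R = {f [^]\<^bsub>Sym\<^esub> (k::nat) | k. True}"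
proof -
  let ?P = "perm_subgroup S R"
  interpret Y: group Sym by (rule group_BijGroup)
  have R: "subgroup R Sym" and iso: "?P \<cong> G"
    using assms by (auto simp: G_regular_def regular_subgroup_def)
  interpret P: group ?P using R by (rule Y.subgroup_imp_group)
  have "finite (carrier ?P)" using iso_finite[OF iso] finite_carrier by simp
  moreover have "cyclic_group ?P"
    using isomorphic_group_cyclicity[OF iso P.is_group is_group] cyclic_group
      gen_closed carrier_eq by blast
  then obtain f where f: "f \<in> carrier ?P" "carrier ?P = range (\<lambda>i::int. f [^]\<^bsub>?P\<^esub> i)"
    using P.cyclic_group by blast
  ultimately have "carrier ?P = {f [^]\<^bsub>?P\<^esub> k | k. k \<in> (UNIV :: nat set)}"
    using P.generate_pow_on_finite_carrier P.generate_pow[OF f(1)] full_SetCompr_eq by auto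
  then show thesis using f(1) that[of f] by (simp add: Y.nat_pow_consistent[symmetric])
qed

lemma regular_subgroup_transitive:
  assumes "regular_subgroup S R" "x \<in> S" "y \<in> S"
  obtains r where "r \<in> R" "r x = y"
proof -
  interpret transitive_action "perm_subgroup S R" S "\<lambda>f. f"
    using assms(1) by (simp add: regular_subgroup_def)
  show thesis using unique_orbit[OF assms(2,3)] that by auto
qed

text \<open>
  A set mapped into itself by a generator is mapped into itself by all nonnegative powers, hence
  by the whole regular group; transitivity leaves no room for a proper subset.
\<close>
lemma regular_generator_no_invariant:
  assumes R: "regular_subgroup S R" and f: "f \<in> R" "R = {f [^]\<^bsub>Sym\<^esub> (k::nat) | k. True}"
    and T: "T \<subseteq> S" "T \<noteq> {}" "f ` T \<subseteq> T"
  shows "T = S"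
proof -
  interpret Y: group Sym by (rule group_BijGroup)
  have RS: "subgroup R Sym" using R by (simp add: regular_subgroup_def)
  have fY: "f \<in> carrier Sym" using subgroup.subset[OF RS] f(1) by blast
  have inv: "(f [^]\<^bsub>Sym\<^esub> (k::nat)) t \<in> T" if "t \<in> T" for t k
    using that
  proof (induction k arbitrary: t)
    case 0
    then show ?case using T(1) by (auto simp: BijGroup_def)
  next
    case (Suc k)
    have "f [^]\<^bsub>Sym\<^esub> Suc k = compose S (f [^]\<^bsub>Sym\<^esub> k) f"
      using Y.nat_pow_closed[OF fY, of k] fY by (simp add: Sym_mult carrier_Sym)
    then show ?case using Suc T by (auto simp: compose_def)
  qed
  obtain t where t: "t \<in> T" using T(2) by blast
  have "x \<in> T" if "x \<in> S" for x
  proof -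
    obtain r where "r \<in> R" "r t = x"
      using regular_subgroup_transitive[OF R _ \<open>x \<in> S\<close>, of t] t T(1) by blast
    then show ?thesis using inv[OF t] f(2) by auto
  qed
  then show ?thesis using T(1) by blast
qed

definition residue_classes :: "int \<Rightarrow> int set \<Rightarrow> 'a set"
  where "residue_classes m C = {g [^] i | i. \<exists>c\<in>C. m dvd i - c}"

lemma gen_pow_mem_residue_classes:
  assumes "m dvd N"
  shows "g [^] (i::int) \<in> residue_classes m C \<longleftrightarrow> (\<exists>c\<in>C. m dvd i - c)"
proof
  assume "g [^] i \<in> residue_classes m C"
  then obtain j c where "g [^] i = g [^] (j::int)" and c: "c \<in> C" "m dvd j - c"
    by (auto simp: residue_classes_def)
  then have "m dvd i - j" using assms by (auto simp: gen_pow_eq_iff intro: dvd_trans)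
  then have "m dvd (i - j) + (j - c)" using c(2) by (rule dvd_add)
  then show "\<exists>c\<in>C. m dvd i - c" using c(1) by auto
qed (auto simp: residue_classes_def)

lemma residue_classes_subset: "residue_classes m C \<subseteq> S"
  by (auto simp: residue_classes_def)

text \<open>
  The invariant sets needed below are unions of residue classes of exponents modulo a divisor of
  \<open>N\<close>, for which invariance is a statement about integers only.
\<close>
lemma affine_generator_no_invariant:
  assumes R: "regular_subgroup S R" "affine a b \<in> R"
      "R = {affine a b [^]\<^bsub>Sym\<^esub> (k::nat) | k. True}"
    and m: "m dvd N" and C: "C \<noteq> {}"
    and inv: "\<And>i c. c \<in> C \<Longrightarrow> m dvd i - c \<Longrightarrow> \<exists>d\<in>C. m dvd a * i + b - d"
  shows "\<exists>c\<in>C. m dvd i - c"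
proof -
  have "residue_classes m C = S"
  proof (rule regular_generator_no_invariant[OF R])
    obtain c where "c \<in> C" using C by blast
    then have "g [^] c \<in> residue_classes m C" using gen_pow_mem_residue_classes[OF m] by force
    then show "residue_classes m C \<noteq> {}" by blast
    show "affine a b ` residue_classes m C \<subseteq> residue_classes m C"
      using inv by (auto simp: residue_classes_def)
  qed (rule residue_classes_subset)
  then show ?thesis using gen_pow_mem_residue_classes[OF m] gen_pow_closed by blast
qed

text \<open>
  If \<open>a \<noteq> 1\<close> modulo \<open>q\<close>, then \<open>i \<mapsto> a i + b\<close> has a fixed point modulo \<open>q\<close>, whose residue class is a proper
  invariant set.
\<close>
lemma regular_generator_cong_1_prime:
  assumes R: "regular_subgroup S R" "affine a b \<in> R"
      "R = {affine a b [^]\<^bsub>Sym\<^esub> (k::nat) | k. True}"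
    and q: "prime q" "q dvd N"
  shows "q dvd a - 1"
proof (rule ccontr)
  assume "\<not> q dvd a - 1"
  then have "coprime (a - 1) q" using q(1) by (metis coprime_commute prime_imp_coprime)
  then obtain u where "[(a - 1) * u = 1] (mod q)" using cong_solve_coprime_int by blast
  then have "[(a - 1) * u * - b = 1 * - b] (mod q)" by (rule cong_scalar_right)
  then have "q dvd (a - 1) * u * - b - 1 * - b" by (simp only: cong_iff_dvd_diff)
  then have "q dvd (a - 1) * (- u * b) + b" by (simp add: algebra_simps)
  then obtain x where x: "q dvd (a - 1) * x + b" by blast
  have "\<exists>c\<in>{x}. q dvd (x + 1) - c"
  proof (rule affine_generator_no_invariant[OF R q(2)])
    fix i c assume c: "c \<in> {x}" "q dvd i - c"
    have "q dvd a * (i - x) + ((a - 1) * x + b)"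
      using c x by (simp only: singleton_iff dvd_add dvd_mult)
    then show "\<exists>d\<in>{x}. q dvd a * i + b - d" by (simp add: algebra_simps)
  qed simp
  then show False using q(1) by (simp add: not_prime_unit)
qed

text \<open>
  By the case \<open>q = 2\<close> the multiplier is odd. If it were \<open>-1\<close> modulo \<open>4\<close>, the map would exchange the
  classes of \<open>0\<close> and \<open>b\<close> modulo \<open>4\<close>, and these cannot exhaust all classes.
\<close>
lemma regular_generator_cong_1_four:
  assumes R: "regular_subgroup S R" "affine a b \<in> R"
      "R = {affine a b [^]\<^bsub>Sym\<^esub> (k::nat) | k. True}"
    and four: "4 dvd N"
  shows "4 dvd a - 1"
proof (rule ccontr)
  assume a: "\<not> 4 dvd a - 1"
  have "2 dvd N" using four by (rule dvd_trans[rotated]) simp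
  then have "2 dvd a - 1" using regular_generator_cong_1_prime[OF R, of 2] by simp
  with a have a4: "4 dvd a + 1" by presburger
  have *: "\<exists>c\<in>{0, b}. 4 dvd i - c" for i
  proof (rule affine_generator_no_invariant[OF R four])
    fix i c assume c: "c \<in> {0, b}" "4 dvd i - c"
    then consider "4 dvd i" | "4 dvd i - b" by auto
    then show "\<exists>d\<in>{0, b}. 4 dvd a * i + b - d"
    proof cases
      case 2
      have "4 dvd a * (i - b) + (a + 1) * b" using 2 a4 by (intro dvd_add) simp_all
      then show ?thesis by (simp add: algebra_simps)
    qed simp
  qed simp
  have "4 dvd 1 - b" "4 dvd 2 - b" using *[of 1] *[of 2] by simp_all
  then have "4 dvd (2 - b) - (1 - b)" by (rule dvd_diff[rotated])
  then show False by simp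
qed

text \<open>Once all translations are present, membership depends on the multiplier alone.\<close>
lemma affine_power_mem:
  assumes K: "subgroup K Sym" "right_translations G \<subseteq> K" and ab: "affine a b \<in> K"
  shows "affine (a ^ t) d \<in> K"
proof (induction t arbitrary: d)
  case 0
  then show ?case using K(2) by (auto simp: right_translations_eq)
next
  case (Suc t)
  have "compose S (affine a b) (affine (a ^ t) 0) \<in> K"
    using perm_subgroup_compose[OF K(1) ab Suc] .
  then have "affine (a * a ^ t) b \<in> K" by (simp add: compose_affine)
  moreover have "affine 1 (d - b) \<in> K" using K(2) by (auto simp: right_translations_eq)
  ultimately have "compose S (affine 1 (d - b)) (affine (a * a ^ t) b) \<in> K"
    by (intro perm_subgroup_compose[OF K(1)])
  then show ?case by (simp add: compose_affine)
qed

lemma two_closed_iff: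
  assumes "subgroup K Sym"
  shows "two_closed S K \<longleftrightarrow> (\<forall>f\<in>Bij S. (\<forall>x\<in>S. \<forall>y\<in>S. \<exists>k\<in>K. f x = k x \<and> f y = k y) \<longrightarrow> f \<in> K)"
  using perm_subgroup_mem_closed(1)[OF assms] unfolding two_closed_def two_closure_eq[OF assms] by blast

text \<open>
  On exponents this adds \<open>m\<close> to the multiples of \<open>p\<close> and fixes everything else. With \<open>m = N/p\<close> it
  witnesses that certain groups of affine maps fail to be \<open>2\<close>-closed.
\<close>
definition shift_residue :: "int \<Rightarrow> int \<Rightarrow> 'a \<Rightarrow> 'a"
  where "shift_residue p m = (\<lambda>x\<in>S. if x \<in> residue_classes p {0} then x \<otimes> g [^] m else x)"

lemma shift_residue_gen_pow:
  assumes "p dvd N"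
  shows "shift_residue p m (g [^] i) = g [^] (if p dvd i then i + m else i)"
  using gen_pow_mem_residue_classes[OF assms, of i "{0}"]
  by (auto simp: shift_residue_def int_pow_mult gen_closed)

lemma shift_residue_Bij:
  assumes "p dvd N" "p dvd m"
  shows "shift_residue p m \<in> Bij S"
proof (rule injective_imp_Bij)
  show "shift_residue p m \<in> extensional S" by (simp add: shift_residue_def)
  show "shift_residue p m ` S \<subseteq> S" by (auto elim!: carrierE simp: shift_residue_gen_pow assms)
  show "inj_on (shift_residue p m) S"
  proof (rule inj_onI)
    fix x y assume "x \<in> S" "y \<in> S" and e: "shift_residue p m x = shift_residue p m y"
    then obtain i j where ij: "x = g [^] (i::int)" "y = g [^] (j::int)" by (metis carrierE)
    have d: "N dvd (if p dvd i then i + m else i) - (if p dvd j then j + m else j)"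
      using e unfolding ij by (simp only: shift_residue_gen_pow[OF assms(1)] gen_pow_eq_iff)
    then have "p dvd (if p dvd i then i + m else i) - (if p dvd j then j + m else j)"
      using assms(1) by (rule dvd_trans[rotated])
    then have "p dvd i \<longleftrightarrow> p dvd j" using assms(2)
      by (auto split: if_splits simp: dvd_diff_left_iff dvd_diff_right_iff dvd_add_left_iff)
    then show "x = y" using d unfolding ij by (auto simp: gen_pow_eq_iff split: if_splits)
  qed
qed

text \<open>
  For odd \<open>p\<close> the exponents \<open>1\<close> and \<open>2\<close> are both fixed, and an affine map fixing two consecutive
  exponents is the identity; but \<open>0\<close> is moved. For \<open>p = 2\<close> and even \<open>N\<close> the map with
  \<open>m = N/2\<close> is affine, which is
  what makes the prime \<open>2\<close> exceptional.
\<close>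
lemma shift_residue_not_affine:
  assumes "int p dvd N" "prime p" "p \<noteq> 2" "\<not> N dvd m"
  shows "shift_residue p m \<noteq> affine a b"
proof
  assume e: "shift_residue p m = affine a b"
  have "\<not> int p dvd 1" using prime_gt_1_nat[OF assms(2)] by simp
  moreover have "\<not> int p dvd 2" using assms(2,3)
    by (metis int_dvd_int_iff of_nat_numeral primes_dvd_imp_eq two_is_prime_nat)
  ultimately have "N dvd m - b" "N dvd 1 - (a + b)" "N dvd 2 - (a * 2 + b)"
    using fun_cong[OF e, of "g [^] (0::int)"] fun_cong[OF e, of "g [^] (1::int)"]
      fun_cong[OF e, of "g [^] (2::int)"]
    by (simp_all only: shift_residue_gen_pow[OF assms(1)] affine_gen_pow gen_pow_eq_iff) simp_all
  then have "N dvd (m - b) - 2 * (1 - (a + b)) + (2 - (a * 2 + b))"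
    by (simp only: dvd_add dvd_diff dvd_mult)
  then show False using assms(4) by simp
qed

text \<open>
  A pair whose exponents agree modulo \<open>p\<close> is moved by a common translation. Otherwise the
  difference of the exponents is prime to \<open>p\<close>; since \<open>c\<^sup>t = 1 + t (c - 1)\<close> modulo \<open>N\<close>, a suitable power
  \<open>c\<^sup>t\<close> changes it by any prescribed multiple of \<open>m = N/p\<close>, and a translation then corrects the
  position.
\<close>
lemma shift_residue_two_closure:
  assumes K: "subgroup K Sym" "right_translations G \<subseteq> K" and ab: "affine c b \<in> K"
    and p: "prime p" and N: "N = int p * m" "int p dvd m" "m dvd c - 1" "\<not> N dvd c - 1"
    and xy: "x \<in> S" "y \<in> S"
  shows "\<exists>k\<in>K. shift_residue p m x = k x \<and> shift_residue p m y = k y"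
proof -
  obtain i j where ij: "x = g [^] (i::int)" "y = g [^] (j::int)" using xy by (metis carrierE)
  have pN: "int p dvd N" using N by simp
  define e where "e i = (if int p dvd i then m else 0)" for i
  have e: "shift_residue p m (g [^] i) = g [^] (i + e i)" for i
    by (simp add: shift_residue_gen_pow[OF pN] e_def)
  obtain u where u: "c = 1 + m * u" using N(3) by (metis dvdE diff_add_cancel add.commute)
  have "\<not> int p dvd u" using N(1,4) u by auto
  have "\<exists>t. N dvd c ^ t * (i - j) - ((i + e i) - (j + e j))"
  proof (cases "int p dvd i - j")
    case True
    then have "int p dvd i \<longleftrightarrow> int p dvd j" by (metis dvd_diff_right_iff dvd_diff_left_iff diff_diff_eq2 dvd_add_right_iff diff_add_cancel)
    then have "e i = e j" by (simp add: e_def)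
    then show ?thesis by (intro exI[of _ 0]) simp
  next
    case False
    have "m dvd e i - e j" by (simp add: e_def)
    then obtain s where s: "e i - e j = m * s" ..
    have "coprime (u * (i - j)) (int p)"
      using p False \<open>\<not> int p dvd u\<close>
      by (metis coprime_commute prime_dvd_mult_iff prime_imp_coprime prime_nat_int_transfer)
    then obtain v where v: "[u * (i - j) * v = 1] (mod int p)"
      using cong_solve_coprime_int by blast
    define t where "t = nat ((v * s) mod int p)"
    have "int t = (v * s) mod int p" using p prime_gt_0_nat by (simp add: t_def)
    then have "[int t = v * s] (mod int p)" by (simp add: cong_def)
    then have "[u * (i - j) * int t = u * (i - j) * (v * s)] (mod int p)" by (rule cong_scalar_left)
    also have "[u * (i - j) * (v * s) = 1 * s] (mod int p)"
      using cong_scalar_right[OF v, of s] by (simp add: mult.assoc)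
    finally have "int p dvd u * (i - j) * int t - s" by (simp add: cong_iff_dvd_diff)
    then have d: "N dvd m * (u * (i - j) * int t - s)" unfolding N(1) by (simp add: mult.commute)
    have mm: "N dvd m * m" unfolding N(1) using N(2) by (simp add: mult_dvd_mono)
    \<comment> \<open>First-order binomial expansion; \<open>m\<^sup>2\<close> vanishes modulo \<open>N\<close> because \<open>p\<close> divides \<open>m\<close>.\<close>
    have "N dvd c ^ t - (1 + int t * m * u)"
    proof (induction t)
      case (Suc t)
      have "c ^ Suc t - (1 + int (Suc t) * m * u) =
          c * (c ^ t - (1 + int t * m * u)) + m * m * (int t * u * u)"
        by (simp add: u algebra_simps)
      moreover have "N dvd \<dots>" using Suc mm by (intro dvd_add) (auto intro: dvd_mult2)
      ultimately show ?case by simp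
    qed simp
    then have "N dvd (c ^ t - (1 + int t * m * u)) * (i - j) + m * (u * (i - j) * int t - s)"
      using d by (simp only: dvd_add dvd_mult2)
    also have "\<dots> = c ^ t * (i - j) - ((i + e i) - (j + e j))"
      using s by (simp add: algebra_simps)
    finally show ?thesis by blast
  qed
  then obtain t where t: "N dvd c ^ t * (i - j) - ((i + e i) - (j + e j))" by blast
  show ?thesis
  proof
    show "affine (c ^ t) (i + e i - c ^ t * i) \<in> K" by (rule affine_power_mem[OF K ab])
    show "shift_residue p m x = affine (c ^ t) (i + e i - c ^ t * i) x \<and>
      shift_residue p m y = affine (c ^ t) (i + e i - c ^ t * i) y"
      using t by (simp add: ij e gen_pow_eq_iff algebra_simps)
  qed
qed

lemma NCI2_if_not_8_dvd:
  assumes "\<not> 8 dvd order G"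
  shows "NCI2_group G"
  unfolding NCI2_group_def
proof (intro allI impI, elim conjE)
  fix K assume K: "subgroup K Sym" "right_translations G \<subseteq> K" and hol: "K \<subseteq> holomorph G"
    and closed: "two_closed S K"
  show "G_transjugate G K"
    unfolding transjugate_iff[OF K(1) hol]
  proof (intro allI impI, elim conjE)
    fix R assume R: "G_regular G R" "R \<subseteq> K"
    then have reg: "regular_subgroup S R" by (simp add: G_regular_def)
    then have RS: "subgroup R Sym" by (simp add: regular_subgroup_def)
    obtain f where f: "f \<in> R" "R = {f [^]\<^bsub>Sym\<^esub> (k::nat) | k. True}"
      using G_regular_generator[OF R(1)] .
    have "f \<in> holomorph G" using f(1) R(2) hol by blast
    then obtain a b where ab: "f = affine a b" by (rule holomorph_imp_affine)
    note gen = reg f[unfolded ab]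
    have "N dvd a - 1"
    proof (rule ccontr)
      assume "\<not> N dvd a - 1"
      moreover have "\<not> 8 dvd N" using assms by presburger
      ultimately obtain t p where p: "prime (p::nat)" "p \<noteq> 2" "int p * int p dvd N"
        "N dvd int p * (a ^ t - 1)" "\<not> N dvd a ^ t - 1"
        using power_of_prime_order[OF N_pos _ _ regular_generator_cong_1_prime[OF gen]
            regular_generator_cong_1_four[OF gen], of thesis] by blast
      have p0: "int p \<noteq> 0" using p(1) by auto
      obtain m where m: "N = int p * m" using p(3) by (meson dvd_mult_left dvdE)
      have pm: "int p dvd m" using p(3) p0 unfolding m by simp
      have mc: "m dvd a ^ t - 1" using p(4) p0 unfolding m by simp
      have "affine (a ^ t) 0 \<in> K"
        using affine_power_mem[OF K] f(1) R(2) ab by blast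
      then have "\<forall>x\<in>S. \<forall>y\<in>S. \<exists>k\<in>K. shift_residue p m x = k x \<and> shift_residue p m y = k y"
        using shift_residue_two_closure[OF K _ p(1) m pm mc p(5)] by blast
      moreover have "shift_residue p m \<in> Bij S"
        using shift_residue_Bij pm m by simp
      ultimately have "shift_residue p m \<in> K"
        using closed two_closed_iff[OF K(1)] by blast
      then obtain c d where "shift_residue p m = affine c d"
        using hol holomorph_imp_affine by blast
      moreover have "\<not> N dvd m"
      proof
        assume "N dvd m"
        then have "int p * m dvd 1 * m" unfolding m by simp
        moreover have "m \<noteq> 0" using m N_pos by auto
        ultimately have "int p dvd 1" by (simp only: dvd_mult_cancel_right) simp
        then show False using prime_gt_1_nat[OF p(1)] by simp
      qed
      ultimately show False using shift_residue_not_affine[OF _ p(1,2)] m by simp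
    qed
    then have "f \<in> right_translations G"
      using ab affine_eq_iff[of a b 1 b] by (auto simp: right_translations_eq)
    then obtain d where d: "f = affine 1 d" by (auto simp: right_translations_eq)
    have "f [^]\<^bsub>Sym\<^esub> (k::nat) = affine 1 (int k * d)" for k
      by (induction k) (simp_all add: one_Sym d mult_affine algebra_simps)
    then have sub: "R \<subseteq> right_translations G"
      unfolding f(2) by (auto simp: right_translations_eq)
    show "R = right_translations G"
    proof (rule subset_antisym[OF sub])
      show "right_translations G \<subseteq> R"
        unfolding right_translations_eq
      proof safe
        fix d :: int
        obtain r where r: "r \<in> R" "r (g [^] (0::int)) = g [^] d"
          by (rule regular_subgroup_transitive[OF reg gen_pow_closed[of 0] gen_pow_closed[of d]])
        then obtain d' where d': "r = affine 1 d'" using sub by (auto simp: right_translations_eq)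
        then have "r = affine 1 d" using r(2) by (simp add: affine_eq_iff gen_pow_eq_iff del: int_pow_0)
        then show "affine 1 d \<in> R" using r(1) by simp
      qed
    qed
  qed
qed

end

section \<open>Orders divisible by eight\<close>

locale finite_cyclic_group_8_dvd = finite_cyclic_group +
  assumes eight: "8 dvd N"
begin

definition half where "half = N div 2"

lemma N_eq: "N = 2 * half" and four_dvd_half: "4 dvd half"
  using eight unfolding half_def by presburger+

lemma N_dvd_half_even: "2 dvd i \<Longrightarrow> N dvd half * i"
  by (auto simp: N_eq)

lemma half_square: "N dvd half * half"
  using four_dvd_half by (intro N_dvd_half_even) presburger

lemma half_square_mult: "N dvd half * half * i"
  using half_square by (rule dvd_mult2)

lemma involution: "N dvd (1 + i * half) * (1 + i * half) - 1"
proof -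
  have "(1 + i * half) * (1 + i * half) - 1 = N * i + half * half * (i * i)"
    unfolding N_eq by (simp add: algebra_simps)
  then show ?thesis using half_square_mult by simp
qed

lemma coprime_involution: "coprime (1 + i * half) N"
proof (rule coprimeI)
  fix d assume d: "d dvd 1 + i * half" "d dvd N"
  have "d dvd (1 + i * half) * (1 + i * half) - 1" using d(2) involution by (rule dvd_trans)
  moreover have "d dvd (1 + i * half) * (1 + i * half)" using d(1) by (rule dvd_mult2)
  ultimately have "d dvd (1 + i * half) * (1 + i * half) -
      ((1 + i * half) * (1 + i * half) - 1)" by (rule dvd_diff[rotated])
  then show "d dvd 1" by simp
qed

definition half_affine where "half_affine = {affine (1 + i * half) b | i b. True}"

lemma affine_mem_half_affine: "N dvd a - (1 + i * half) \<Longrightarrow> affine a b \<in> half_affine"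
  unfolding half_affine_def using affine_eq_iff[of a b "1 + i * half" b] by auto

lemma half_affine_mult:
  "affine (1 + i * half) b \<otimes>\<^bsub>Sym\<^esub> affine (1 + j * half) d =
    affine (1 + (i + j) * half) ((1 + i * half) * d + b)"
proof -
  have "(1 + i * half) * (1 + j * half) - (1 + (i + j) * half) = half * half * (i * j)"
    by (simp add: algebra_simps)
  then have "N dvd (1 + i * half) * (1 + j * half) - (1 + (i + j) * half)"
    using half_square_mult by simp
  then show ?thesis by (simp add: mult_affine coprime_involution affine_eq_iff)
qed

lemma half_affine_subgroup: "subgroup half_affine Sym"
proof -
  interpret Y: group Sym by (rule group_BijGroup)
  show ?thesis
  proof (rule Y.subgroupI)
    show "half_affine \<subseteq> carrier Sym"
      by (auto simp: half_affine_def carrier_Sym affine_Bij coprime_involution)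
    show "half_affine \<noteq> {}" by (auto simp: half_affine_def)
  next
    fix f assume "f \<in> half_affine"
    then obtain i b where f: "f = affine (1 + i * half) b" by (auto simp: half_affine_def)
    have "inv\<^bsub>Sym\<^esub> f = affine (1 + (- i) * half) (- (1 + (- i) * half) * b)"
    proof (rule Y.inv_equality)
      show "affine (1 + (- i) * half) (- (1 + (- i) * half) * b) \<otimes>\<^bsub>Sym\<^esub> f = \<one>\<^bsub>Sym\<^esub>"
        unfolding f half_affine_mult one_Sym by (simp add: algebra_simps)
    qed (simp_all add: f carrier_Sym affine_Bij coprime_involution del: mult_minus_left)
    then show "inv\<^bsub>Sym\<^esub> f \<in> half_affine" unfolding half_affine_def by blast
  next
    fix f f' assume "f \<in> half_affine" "f' \<in> half_affine"
    then show "f \<otimes>\<^bsub>Sym\<^esub> f' \<in> half_affine" unfolding half_affine_def using half_affine_mult by blast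
  qed
qed

lemma half_affine_translations: "right_translations G \<subseteq> half_affine"
  using affine_mem_half_affine[of 1 0] by (auto simp: right_translations_eq)

lemma half_affine_holomorph: "half_affine \<subseteq> holomorph G"
  by (auto simp: half_affine_def intro!: affine_holomorph coprime_involution)

text \<open>
  A multiplier \<open>1 + k N/2\<close> leaves even differences alone and adds \<open>k N/2\<close> to odd ones. So a permutation
  agreeing with the group on pairs is a translation on each parity class of exponents, and the
  images of \<open>0\<close> and \<open>1\<close> determine it; they prescribe an affine map of the group.
\<close>
lemma half_affine_two_closed: "two_closed S half_affine"
  unfolding two_closed_iff[OF half_affine_subgroup]
proof (intro ballI impI)
  fix f assume fB: "f \<in> Bij S" and pairs: "\<forall>x\<in>S. \<forall>y\<in>S. \<exists>k\<in>half_affine. f x = k x \<and> f y = k y"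
  have "\<forall>i::int. \<exists>j::int. f (g [^] i) = g [^] j"
    using Bij_imp_funcset[OF fB] by (metis carrierE funcset_mem gen_pow_closed)
  then obtain F :: "int \<Rightarrow> int" where F: "f (g [^] i) = g [^] F i" for i by metis
  have diff: "\<exists>k. N dvd F i - F j - (1 + k * half) * (i - j)" for i j
  proof -
    obtain k b where "f (g [^] i) = affine (1 + k * half) b (g [^] i)"
        "f (g [^] j) = affine (1 + k * half) b (g [^] j)"
      using pairs gen_pow_closed unfolding half_affine_def by blast
    then have "N dvd (F i - ((1 + k * half) * i + b)) - (F j - ((1 + k * half) * j + b))"
      by (simp only: F affine_gen_pow gen_pow_eq_iff dvd_diff)
    also have "\<dots> = F i - F j - (1 + k * half) * (i - j)" by (simp add: algebra_simps)
    finally show ?thesis by blast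
  qed
  have even: "N dvd F i - F j - (i - j)" if "2 dvd i - j" for i j
  proof -
    obtain k where "N dvd F i - F j - (1 + k * half) * (i - j)" using diff by blast
    moreover have "N dvd half * (i - j) * k" using N_dvd_half_even[OF that] by simp
    ultimately have "N dvd F i - F j - (1 + k * half) * (i - j) + half * (i - j) * k"
      by (rule dvd_add)
    then show ?thesis by (simp add: algebra_simps)
  qed
  obtain k where k: "N dvd F 1 - F 0 - (1 + k * half) * (1 - 0)" using diff by blast
  have "N dvd F i - ((1 + k * half) * i + F 0)" for i
  proof (cases "2 dvd i")
    case True
    have "N dvd (F i - F 0 - (i - 0)) - half * i * k"
      using even[of i 0] N_dvd_half_even[OF True] True
      by (simp only: diff_zero dvd_diff dvd_mult2)
    then show ?thesis by (simp add: algebra_simps)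
  next
    case False
    then have o: "2 dvd i - 1" by presburger
    have "N dvd (F i - F 1 - (i - 1)) + (F 1 - F 0 - (1 + k * half) * (1 - 0))
        - half * (i - 1) * k"
      using even[OF o] N_dvd_half_even[OF o] k by (simp only: dvd_diff dvd_add dvd_mult2)
    then show ?thesis by (simp add: algebra_simps)
  qed
  then have "f = affine (1 + k * half) (F 0)"
    by (intro extensional_eqI) (simp_all add: Bij_imp_extensional[OF fB] F gen_pow_eq_iff)
  then show "f \<in> half_affine" unfolding half_affine_def by blast
qed

text \<open>
  These are the powers of \<open>i \<mapsto> (1 + N/2) i + 1\<close>, indexed by their value at exponent \<open>0\<close>: the
  multiplier is \<open>1 + N/2\<close> exactly when the translation part is odd. The index does not add up
  under composition, see \<open>twist_mult\<close>, but the group is generated by \<open>twist 1\<close> all the same.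
\<close>
definition twist where "twist j = affine (1 + j * half) j"

definition twisted where "twisted = range twist"

lemma twist_gen_pow: "twist j (g [^] i) = g [^] (i + j * (1 + i * half))"
  by (simp add: twist_def algebra_simps)

lemma twist_eq_iff: "twist i = twist j \<longleftrightarrow> N dvd i - j"
  by (auto simp: twist_def affine_eq_iff left_diff_distrib[symmetric])

lemma twist_mem_Sym: "twist j \<in> carrier Sym"
  by (simp add: twist_def carrier_Sym affine_Bij coprime_involution)

lemma twist_mult: "twist j \<otimes>\<^bsub>Sym\<^esub> twist i = twist (i + j + i * j * half)"
  unfolding twist_def
  by (simp add: mult_affine coprime_involution) (simp add: algebra_simps)

lemma one_Sym_twist: "\<one>\<^bsub>Sym\<^esub> = twist 0"
  by (simp add: one_Sym twist_def)

lemma twisted_subgroup: "subgroup twisted Sym"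
proof -
  interpret Y: group Sym by (rule group_BijGroup)
  show ?thesis
  proof (rule Y.subgroupI)
    show "twisted \<subseteq> carrier Sym" by (auto simp: twisted_def twist_mem_Sym)
    show "twisted \<noteq> {}" by (simp add: twisted_def)
  next
    fix f assume "f \<in> twisted"
    then obtain j where f: "f = twist j" by (auto simp: twisted_def)
    let ?i = "- j * (1 + j * half)"
    have "j + ?i + j * ?i * half - 0 = - (N * (j * j) + half * half * (j * j * j))"
      unfolding N_eq by (simp add: algebra_simps)
    moreover have "N dvd \<dots>" using half_square_mult by simp
    ultimately have "twist (j + ?i + j * ?i * half) = twist 0" unfolding twist_eq_iff by simp
    then have "inv\<^bsub>Sym\<^esub> f = twist ?i"
      unfolding f by (intro Y.inv_equality) (simp_all only: twist_mult one_Sym_twist twist_mem_Sym)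
    then show "inv\<^bsub>Sym\<^esub> f \<in> twisted" by (simp add: twisted_def)
  next
    fix f f' assume "f \<in> twisted" "f' \<in> twisted"
    then show "f \<otimes>\<^bsub>Sym\<^esub> f' \<in> twisted" by (auto simp: twisted_def twist_mult)
  qed
qed

lemma twisted_group: "group (perm_subgroup S twisted)"
  by (rule group.subgroup_imp_group[OF group_BijGroup twisted_subgroup])

text \<open>
  Moving exponent \<open>i\<close> to \<open>k\<close> means solving \<open>j (1 + i N/2) = k - i\<close> modulo \<open>N\<close>. As \<open>1 + i N/2\<close> is its own
  inverse modulo \<open>N\<close>, there is exactly one solution, which gives transitivity and trivial
  stabilizers.
\<close>
lemma twisted_regular: "regular_subgroup S twisted"
  unfolding regular_subgroup_def
proof (intro conjI ballI)
  show "subgroup twisted Sym" by (rule twisted_subgroup)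
  show "transitive_action (perm_subgroup S twisted) S (\<lambda>f. f)"
  proof (intro transitive_action.intro group_action.intro group_hom.intro
      group_hom_axioms.intro transitive_action_axioms.intro twisted_group group_BijGroup)
    show "(\<lambda>f. f) \<in> hom (perm_subgroup S twisted) Sym"
      using subgroup.subset[OF twisted_subgroup] by (auto simp: hom_def)
    fix x y assume "x \<in> S" "y \<in> S"
    then obtain i k where xy: "x = g [^] (i::int)" "y = g [^] (k::int)" by (metis carrierE)
    let ?j = "(k - i) * (1 + i * half)"
    have "N dvd (k - i) * ((1 + i * half) * (1 + i * half) - 1)"
      using involution by (rule dvd_mult)
    then have "twist ?j x = y" unfolding xy twist_gen_pow gen_pow_eq_iff
      by (simp add: algebra_simps)
    then show "\<exists>r\<in>carrier (perm_subgroup S twisted). r x = y" by (auto simp: twisted_def)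
  qed
  fix x assume "x \<in> S"
  then obtain i where x: "x = g [^] (i::int)" by (rule carrierE)
  have "twist j x = x \<longleftrightarrow> twist j = twist 0" for j
    using coprime_involution[of i]
    by (simp add: x twist_gen_pow gen_pow_eq_iff twist_eq_iff coprime_commute
        coprime_dvd_mult_left_iff)
  then show "stabilizer (perm_subgroup S twisted) (\<lambda>f. f) x = {\<one>\<^bsub>Sym\<^esub>}"
    unfolding one_Sym_twist by (auto simp: stabilizer_def twisted_def)
qed

text \<open>
  The square of \<open>twist 1\<close> is the translation by \<open>2 + N/2 = 2 (1 + N/4)\<close>. Since \<open>8\<close> divides \<open>N\<close>,
  the factor \<open>1 + N/4\<close> is prime to \<open>N\<close>, so this square generates all even translations, and one more
  factor \<open>twist 1\<close> reaches the odd indices.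
\<close>
lemma twisted_cyclic: "cyclic_group (perm_subgroup S twisted)"
proof -
  let ?P = "perm_subgroup S twisted"
  interpret P: group ?P by (rule twisted_group)
  let ?Q = "range (\<lambda>i::int. twist 1 [^]\<^bsub>?P\<^esub> i)"
  have 1: "twist 1 \<in> carrier ?P" by (simp add: twisted_def)
  have Q: "subgroup ?Q ?P" by (rule P.subgroup_of_powers[OF 1])
  have mult: "twist (i + j + i * j * half) \<in> ?Q" if "twist i \<in> ?Q" "twist j \<in> ?Q" for i j
    using subgroup.m_closed[OF Q that(2,1)] by (simp add: twist_mult)
  have one: "twist 1 \<in> ?Q" using 1 by (metis P.int_pow_1 rangeI)
  have two: "twist (2 + half) \<in> ?Q" using mult[OF one one] by simp
  have even: "twist ((2 + half) * int k) \<in> ?Q" for k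
  proof (induction k)
    case 0
    then show ?case using subgroup.one_closed[OF Q] by (simp add: one_Sym_twist)
  next
    case (Suc k)
    let ?i = "(2 + half) * int k"
    have "2 dvd ?i * (2 + half)" using four_dvd_half by (intro dvd_mult) presburger
    then have "N dvd half * (?i * (2 + half))" by (rule N_dvd_half_even)
    then have "twist (?i + (2 + half) + ?i * (2 + half) * half) = twist ((2 + half) * int (Suc k))"
      unfolding twist_eq_iff by (simp add: algebra_simps)
    then show ?case using mult[OF Suc two] by simp
  qed
  \<comment> \<open>\<open>1 - 2 q = 1 - N/4\<close> is an inverse of \<open>1 + N/4\<close> as far as multiples of \<open>2\<close> modulo \<open>N\<close> are concerned.\<close>
  have even': "twist (2 * m) \<in> ?Q" for m
  proof -
    obtain q where q: "half = 4 * q" using four_dvd_half by blast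
    define k where "k = nat ((1 - 2 * q) * m mod N)"
    have "int k = (1 - 2 * q) * m mod N" using N_pos by (simp add: k_def)
    then have "N dvd int k - (1 - 2 * q) * m"
      by (metis cong_iff_dvd_diff cong_mod_left cong_refl)
    then have "N dvd (2 + half) * (int k - (1 - 2 * q) * m) - N * (q * m)"
      by (simp only: dvd_diff dvd_mult dvd_triv_left)
    then have "N dvd (2 + half) * int k - 2 * m" unfolding N_eq q by (simp add: algebra_simps)
    then show ?thesis using even[of k] by (metis twist_eq_iff)
  qed
  have "twist j \<in> ?Q" for j
  proof (cases "2 dvd j")
    case True
    then show ?thesis using even' by (auto elim!: dvdE)
  next
    case False
    then obtain m where m: "j = 2 * m + 1" by (metis oddE)
    have "twist (2 * m + 1 + 2 * m * 1 * half) = twist j"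
      unfolding twist_eq_iff m N_eq by simp
    then show ?thesis using mult[OF even'[of m] one] by simp
  qed
  then have "carrier ?P = ?Q" using subgroup.subset[OF Q] by (auto simp: twisted_def)
  then show ?thesis using 1 P.cyclic_group by blast
qed

lemma twisted_G_regular: "G_regular G twisted"
proof -
  have "(\<lambda>r. r (g [^] (0::int))) ` twisted = S"
    unfolding twisted_def carrier_eq image_image twist_gen_pow by simp
  moreover have "inj_on (\<lambda>r. r (g [^] (0::int))) twisted"
    by (rule inj_onI) (auto simp: twisted_def twist_gen_pow gen_pow_eq_iff twist_eq_iff simp del: int_pow_0)
  ultimately have b: "bij_betw (\<lambda>r. r (g [^] (0::int))) twisted S" by (simp add: bij_betw_def)
  have "perm_subgroup S twisted \<cong> G"
  proof (rule cyclic_groups_iso[OF twisted_group is_group twisted_cyclic])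
    show "cyclic_group G" using cyclic_group gen_closed carrier_eq by blast
    show "order (perm_subgroup S twisted) = order G"
      using bij_betw_same_card[OF b] by (simp add: order_def)
    show "finite (carrier (perm_subgroup S twisted))"
      using bij_betw_finite[OF b] finite_carrier by simp
  qed (rule finite_carrier)
  then show ?thesis using twisted_regular by (simp add: G_regular_def)
qed

lemma not_NCI2: "\<not> NCI2_group G"
proof
  assume "NCI2_group G"
  then have "G_transjugate G half_affine"
    unfolding NCI2_group_def
    using half_affine_subgroup half_affine_translations half_affine_holomorph half_affine_two_closed by blast
  moreover have "twisted \<subseteq> half_affine" by (auto simp: twisted_def half_affine_def twist_def)
  ultimately have "twisted = right_translations G"
    using transjugate_iff[OF half_affine_subgroup half_affine_holomorph] twisted_G_regular by blast
  moreover have "twist 1 \<in> twisted" by (simp add: twisted_def)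
  ultimately have "N dvd half" by (auto simp: right_translations_eq twist_def affine_eq_iff)
  then show False using N_pos unfolding N_eq by (auto dest: zdvd_imp_le)
qed

end

section \<open>The classification\<close>

theorem corollary1p4:
  fixes G (structure)
  assumes "group G" and "finite (carrier G)" and "cyclic_group G"
  shows "NCI2_group G \<longleftrightarrow> \<not> 8 dvd order G"
proof -
  interpret group G by fact
  obtain g where g: "g \<in> carrier G" "carrier G = range (\<lambda>i::int. g [^] i)"
    using assms(3) cyclic_group by blast
  interpret finite_cyclic_group G g by unfold_locales (use assms(2) g in auto)
  show ?thesis
  proof
    assume "NCI2_group G"
    show "\<not> 8 dvd order G"
    proof
      assume "8 dvd order G"
      then interpret finite_cyclic_group_8_dvd G g by unfold_locales presburger
      show False using not_NCI2 \<open>NCI2_group G\<close> by blast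
    qed
  qed (rule NCI2_if_not_8_dvd)
qed

end
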